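(* Let $$\tilde f(\beta_0,\beta_1) := (\beta_0+\beta_1)\left(\frac{\beta_0^2+\beta_1^2}{68}-\frac{\beta_0\beta_1}{46}-\frac14\right),\qquad (\beta_0,\beta_1)\in\mathbb{R}^2,$$ and let $\delta$ be the angle defect associated with $\tilde f$. There exist constants $c_1,c_2$ such that $$|\delta(\beta_0,\beta_1)|\le \min\bigl\{c_1,\; c_2\,|\beta_0+\beta_1|\,(\beta_0^2+\beta_1^2)\bigr\}$$ for all $(\beta_0,\beta_1)\in B:=[-\pi/2,\pi/2]^2$. A feasible numerical value for both constants is $c_1=c_2=1/800$; that is, the bound holds with $c_1=c_2=1/800$.
   Context: Define the quadratic Lagrange polynomials for the nodes $0,1/2,1$ on $[0,1]$: $\ell^2_0(t)=(t-1)(2t-1)$, $\ell^2_{1/2}(t)=4t(1-t)$, $\ell^2_1(t)=t(2t-1)$. For a continuous function $\beta:[0,1]\to\mathbb{R}$ let $I(\beta):=\int_0^1 e^{i\beta(s)}\,ds\in\mathbb{C}$. For $(\beta_0,\beta_1)$, put $\beta:=\beta_0\ell^2_0+\tilde f(\beta_0,\beta_1)\,\ell^2_{1/2}+\beta_1\ell^2_1$. The angle defect is $\delta(\beta_0,\beta_1):=\arg I(\beta)$, where $\arg$ is the principal argument in radians. *)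

theory Defs
  imports "HOL-Analysis.Analysis"
begin

definition lagrange_0 :: "real \<Rightarrow> real" where
  "lagrange_0 t = (t - 1) * (2 * t - 1)"

definition lagrange_half :: "real \<Rightarrow> real" where
  "lagrange_half t = 4 * t * (1 - t)"

definition lagrange_1 :: "real \<Rightarrow> real" where
  "lagrange_1 t = t * (2 * t - 1)"

definition quad_interp :: "(real \<Rightarrow> real \<Rightarrow> real) \<Rightarrow> real \<Rightarrow> real \<Rightarrow> real \<Rightarrow> real" where
  "quad_interp f \<beta>0 \<beta>1 t =
     \<beta>0 * lagrange_0 t + f \<beta>0 \<beta>1 * lagrange_half t + \<beta>1 * lagrange_1 t"

definition direction_integral :: "(real \<Rightarrow> real) \<Rightarrow> complex" where
  "direction_integral \<beta> = integral {0..1} (\<lambda>s. exp (\<i> * complex_of_real (\<beta> s)))"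

text \<open>
  The library function \<^const>\<open>Arg\<close> is the principal argument with values in \<open>(-pi, pi]\<close>,
  extended by \<open>Arg 0 = 0\<close>; \<open>direction_integral_nonzero\<close> below shows that this extension plays
  no role on the parameter square considered.
\<close>

definition angle_defect :: "(real \<Rightarrow> real \<Rightarrow> real) \<Rightarrow> real \<Rightarrow> real \<Rightarrow> real" where
  "angle_defect f \<beta>0 \<beta>1 = Arg (direction_integral (quad_interp f \<beta>0 \<beta>1))"

definition f_tilde :: "real \<Rightarrow> real \<Rightarrow> real" where
  "f_tilde \<beta>0 \<beta>1 =
     (\<beta>0 + \<beta>1) * ((\<beta>0\<^sup>2 + \<beta>1\<^sup>2) / 68 - \<beta>0 * \<beta>1 / 46 - 1 / 4)"

lemma quad_interp_continuous: "continuous_on S (quad_interp f a b)"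
  unfolding quad_interp_def lagrange_0_def lagrange_half_def lagrange_1_def
  by (intro continuous_intros)

lemma f_tilde_factor:
  assumes "a \<in> {-pi/2..pi/2}" "b \<in> {-pi/2..pi/2}"
  obtains g where "0 \<le> g" "g \<le> 1/4" "f_tilde a b = - (a + b) * g"
proof
  define q where "q = (a\<^sup>2 + b\<^sup>2) / 68 - a * b / 46"
  have ab: "\<bar>a\<bar> \<le> 2" "\<bar>b\<bar> \<le> 2"
    using assms pi_less_4 by auto
  have sq: "a\<^sup>2 \<le> 4" "b\<^sup>2 \<le> 4"
    using abs_le_square_iff[of a 2] abs_le_square_iff[of b 2] ab by auto
  have "0 \<le> (a - b)\<^sup>2" "0 \<le> (a + b)\<^sup>2" by simp_all
  then have p: "2 * (a * b) \<le> a\<^sup>2 + b\<^sup>2" "- (2 * (a * b)) \<le> a\<^sup>2 + b\<^sup>2"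
    by (simp_all add: power2_diff power2_sum)
  have q: "q = a\<^sup>2 / 68 + b\<^sup>2 / 68 - (a * b) / 46"
    unfolding q_def by (simp add: add_divide_distrib)
  have "q \<le> 1/4"
    using p sq q by linarith
  moreover have "0 \<le> q"
    using p q zero_le_power2[of a] zero_le_power2[of b] by linarith
  ultimately show "0 \<le> 1/4 - q" "1/4 - q \<le> 1/4" by simp_all
  show "f_tilde a b = - (a + b) * (1/4 - q)"
  proof -
    have "f_tilde a b = (a + b) * (q - 1/4)"
      unfolding f_tilde_def q_def by (rule refl)
    also have "\<dots> = - (a + b) * (1/4 - q)"
      by (metis minus_diff_eq minus_mult_commute)
    finally show ?thesis .
  qed
qed

lemma quad_interp_f_tilde_bound:
  assumes ab: "a \<in> {-pi/2..pi/2}" "b \<in> {-pi/2..pi/2}" and t: "t \<in> {0..1}"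
  shows "\<bar>quad_interp f_tilde a b t\<bar> \<le> pi/2"
proof -
  obtain g where g: "0 \<le> g" "g \<le> 1/4" "f_tilde a b = - (a + b) * g"
    using f_tilde_factor[OF ab] .
  define h where "h = lagrange_half t"
  define x where "x = lagrange_0 t - g * h"
  define y where "y = lagrange_1 t - g * h"
  have "0 \<le> (2*t - 1)\<^sup>2" by simp
  then have h: "0 \<le> h" "h \<le> 1"
    using t by (auto simp: h_def lagrange_half_def power2_eq_square algebra_simps mult_left_le)
  have gh: "0 \<le> g * h" "g * h \<le> 1/4"
    using g h mult_mono[of g "1/4" h 1] by auto
  have s: "x + y = 1 - h - 2 * (g * h)" and d: "x - y = 1 - 2 * t"
    unfolding x_def y_def h_def lagrange_0_def lagrange_1_def lagrange_half_def
    by (simp_all add: algebra_simps)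
  have xy: "\<bar>x\<bar> + \<bar>y\<bar> \<le> 1"
    using s d gh h t by auto
  have "quad_interp f_tilde a b t = a * x + b * y"
    unfolding quad_interp_def x_def y_def g(3) h_def by (simp add: algebra_simps)
  also have "\<bar>\<dots>\<bar> \<le> \<bar>a\<bar> * \<bar>x\<bar> + \<bar>b\<bar> * \<bar>y\<bar>"
    by (metis abs_mult abs_triangle_ineq)
  also have "\<dots> \<le> pi/2 * \<bar>x\<bar> + pi/2 * \<bar>y\<bar>"
    using ab by (intro add_mono mult_right_mono) auto
  also have "\<dots> = pi/2 * (\<bar>x\<bar> + \<bar>y\<bar>)" by (simp add: algebra_simps)
  also have "\<dots> \<le> pi/2" using mult_left_mono[OF xy, of "pi/2"] by simp
  finally show ?thesis .
qed

lemma direction_integral_nonzero: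
  assumes ab: "a \<in> {-pi/2..pi/2}" "b \<in> {-pi/2..pi/2}"
  shows "direction_integral (quad_interp f_tilde a b) \<noteq> 0"
proof
  let ?\<beta> = "quad_interp f_tilde a b"
  let ?F = "\<lambda>s. exp (\<i> * complex_of_real (?\<beta> s))"
  assume z: "direction_integral ?\<beta> = 0"
  have cont: "continuous_on {0..1} ?F"
    by (intro continuous_intros continuous_on_of_real quad_interp_continuous)
  then have "(?F has_integral 0) {0..1}"
    using z integrable_continuous_real[OF cont] unfolding direction_integral_def
    by (metis integrable_integral)
  from has_integral_linear[OF this bounded_linear_Re]
  have "((\<lambda>s. Re (?F s)) has_integral 0) {0..1}"
    by (simp only: o_def zero_complex.simps)
  then have i: "((\<lambda>s. cos (?\<beta> s)) has_integral 0) (cbox 0 1)"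
    by (simp add: Re_exp)
  have c: "continuous_on (cbox 0 1) (\<lambda>s. cos (?\<beta> s))"
    by (intro continuous_intros quad_interp_continuous)
  have nn: "0 \<le> cos (?\<beta> s)" if "s \<in> {0..1}" for s
    using quad_interp_f_tilde_bound[OF ab that] by (intro cos_ge_zero) auto
  have "cos (?\<beta> (1/2)) = 0"
    using has_integral_0_cbox_imp_0[OF c _ i, of "1/2"] nn by (auto simp: box_real)
  moreover
  obtain g where g: "0 \<le> g" "g \<le> 1/4" "f_tilde a b = - (a + b) * g"
    using f_tilde_factor[OF ab] .
  have "\<bar>a + b\<bar> * g \<le> pi * (1/4)"
    using ab g by (intro mult_mono) auto
  then have "\<bar>?\<beta> (1/2)\<bar> \<le> pi/4"
    using g(1) unfolding quad_interp_def lagrange_0_def lagrange_half_def lagrange_1_def g(3)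
    by (simp add: abs_mult abs_minus_commute flip: abs_minus_cancel[of "a + b"])
  then have "0 < cos (?\<beta> (1/2))"
    using pi_gt_zero by (intro cos_gt_zero_pi) linarith+
  ultimately show False by simp
qed

end

theory Submission
  imports Defs
begin

text \<open>
  Write \<open>s = a + b\<close>, \<open>d = b - a\<close>, \<open>u = 2t - 1\<close> and \<open>w = u\<^sup>2\<close>. In these coordinates the interpolant is
  \<open>\<beta> = d u / 2 + s h(w)\<close> with the profile \<open>h(w) = (3 w - 1) / 4 + e (1 - w)\<close>, where the cubic correction in
  the midpoint rule enters only through \<open>e = (3 s\<^sup>2 + 20 d\<^sup>2) / 1564\<close>. Averaging over \<open>t \<mapsto> 1 - t\<close> removes the
  parts of the integrand that are odd in \<open>u\<close>, so that
  \<open>Im I = \<integral> sin (s h) cos (d u / 2)\<close> and \<open>Re I = \<integral> cos (s h) cos (d u / 2)\<close>.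

  Hence \<open>Im I = s F(p, q)\<close> with \<open>p = s\<^sup>2\<close>, \<open>q = d\<^sup>2\<close> and an entire function \<open>F\<close>. For \<open>e = 0\<close> the profile has
  mean zero, so \<open>F(0, 0) = 0\<close>; this is the role of the coefficient \<open>1/4\<close> in the midpoint rule. The
  coefficients \<open>1/68\<close> and \<open>1/46\<close> make the linear terms of \<open>F\<close> small and opposite in sign to the dominant
  quadratic ones, which keeps \<open>F\<close> small on the whole square. Since \<open>\<bar>arctan x\<bar> \<le> \<bar>x\<bar>\<close> and
  \<open>p + q = 2 (a\<^sup>2 + b\<^sup>2)\<close>, the two bounds of the theorem follow from
  \<open>s \<bar>F\<bar> \<le> Re I / 800\<close> and \<open>\<bar>F\<bar> \<le> (p + q) Re I / 1600\<close>
  on the triangle \<open>s \<ge> 0\<close>, \<open>d \<ge> 0\<close>, \<open>s + d \<le> pi\<close>, which is the square up to the symmetries \<open>s \<mapsto> -s\<close>, \<open>d \<mapsto> -d\<close>.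

  The margins are a few percent, so \<open>F\<close> has to be known accurately. Taylor expansion of \<open>sin y cos z\<close> to
  total degree seven leaves an error that still contains the factor \<open>s\<close> (\<open>sin_mult_cos_taylor\<close>), and all
  integrals that occur are moments of affine functions of \<open>u\<^sup>2\<close>, hence polynomials in \<open>e\<close> with rational
  coefficients. This encloses \<open>F\<close> between
  two cubic polynomials \<open>im_lower\<close> and \<open>im_upper\<close> and bounds \<open>Re I\<close> from below by a quadratic polynomial
  \<open>re_lower\<close>. Four polynomial inequalities remain. Three of them yield to termwise estimates; the upper
  bound on \<open>s F\<close> (\<open>im_upper_le_uniform\<close>) is nearly attained on the edge \<open>s + d = pi\<close> close to \<open>s = 2.15\<close>,
  and there it is reduced by monotonicity in \<open>q\<close> to one polynomial in one variable.
\<close>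

section \<open>Bounds for the argument, sine and cosine\<close>

lemma abs_Arg_le:
  assumes "0 < Re z" "\<bar>Im z\<bar> \<le> c * Re z"
  shows "\<bar>Arg z\<bar> \<le> c"
proof -
  have "\<bar>Arg z\<bar> \<le> \<bar>Im z / Re z\<bar>"
    unfolding arg_conv_arctan[OF assms(1)] by (rule abs_arctan_le)
  also have "\<dots> \<le> c"
    using assms by (simp add: field_simps)
  finally show ?thesis .
qed

lemma cos_taylor_bounds:
  fixes z :: real
  shows "\<bar>cos z - 1\<bar> \<le> z^2/2"
    and "\<bar>cos z - (1 - z^2/2)\<bar> \<le> z^4/24"
    and "\<bar>cos z - (1 - z^2/2 + z^4/24)\<bar> \<le> z^6/720"
    and "\<bar>cos z - (1 - z^2/2 + z^4/24 - z^6/720)\<bar> \<le> z^8/40320"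
proof -
  have rem: "\<bar>cos z - (\<Sum>m<n. cos_coeff m * z ^ m)\<bar> \<le> z ^ n / fact n" if n: "even n" for n
  proof -
    obtain t where t: "cos z = (\<Sum>m<n. cos_coeff m * z ^ m) + cos (t + 1/2 * real n * pi) / fact n * z ^ n"
      using Maclaurin_cos_expansion[of z n] by blast
    then have "\<bar>cos z - (\<Sum>m<n. cos_coeff m * z ^ m)\<bar> = \<bar>cos (t + 1/2 * real n * pi)\<bar> * (z ^ n / fact n)"
      using n by (simp add: abs_mult power_even_abs zero_le_even_power)
    also have "\<dots> \<le> 1 * (z ^ n / fact n)"
      using n by (intro mult_right_mono abs_cos_le_one divide_nonneg_pos zero_le_even_power) auto
    finally show ?thesis by simp
  qed
  show "\<bar>cos z - 1\<bar> \<le> z^2/2" "\<bar>cos z - (1 - z^2/2)\<bar> \<le> z^4/24"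
    "\<bar>cos z - (1 - z^2/2 + z^4/24)\<bar> \<le> z^6/720"
    "\<bar>cos z - (1 - z^2/2 + z^4/24 - z^6/720)\<bar> \<le> z^8/40320"
    using rem[of 2] rem[of 4] rem[of 6] rem[of 8]
    by (simp_all add: cos_coeff_def fact_numeral lessThan_nat_numeral)
qed

lemma sin_taylor_bound:
  fixes y :: real
  shows "\<bar>sin y - (y - y^3/6 + y^5/120 - y^7/5040)\<bar> \<le> \<bar>y\<bar>^9/362880"
  using Maclaurin_sin_bound[of y 9]
  by (simp add: sin_coeff_def fact_numeral lessThan_nat_numeral inverse_eq_divide algebra_simps)

text \<open>
  Each power of \<open>y\<close> in the expansion of \<open>sin y\<close> is multiplied by a Taylor polynomial of \<open>cos z\<close> whose length
  makes the total degree seven. Expanding \<open>sin (y + z)\<close> instead would give an error that does not vanish at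
  \<open>y = 0\<close>; here every error term keeps a factor \<open>y\<close>, which is needed for a bound proportional to \<open>a + b\<close>.
\<close>

lemma sin_mult_cos_taylor:
  fixes y z :: real
  shows "\<bar>sin y * cos z - (y * (1 - z^2/2 + z^4/24 - z^6/720) - y^3/6 * (1 - z^2/2 + z^4/24)
             + y^5/120 * (1 - z^2/2) - y^7/5040)\<bar>
     \<le> \<bar>y\<bar> * (z^8/40320) + \<bar>y\<bar>^3/6 * (z^6/720) + \<bar>y\<bar>^5/120 * (z^4/24)
        + \<bar>y\<bar>^7/5040 * (z^2/2) + \<bar>y\<bar>^9/362880"
proof -
  define a where "a = (sin y - (y - y^3/6 + y^5/120 - y^7/5040)) * cos z"
  define c8 c6 c4 c2 where "c8 = cos z - (1 - z^2/2 + z^4/24 - z^6/720)"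
    and "c6 = cos z - (1 - z^2/2 + z^4/24)" and "c4 = cos z - (1 - z^2/2)" and "c2 = cos z - 1"
  note c = c8_def c6_def c4_def c2_def
  have eq: "sin y * cos z - (y * (1 - z^2/2 + z^4/24 - z^6/720) - y^3/6 * (1 - z^2/2 + z^4/24)
             + y^5/120 * (1 - z^2/2) - y^7/5040)
     = a + y * c8 - y^3/6 * c6 + y^5/120 * c4 - y^7/5040 * c2"
    unfolding a_def c by (simp add: field_simps)
  have "\<bar>a\<bar> \<le> \<bar>y\<bar>^9/362880 * 1"
    unfolding a_def abs_mult by (intro mult_mono sin_taylor_bound abs_cos_le_one) auto
  moreover have "\<bar>y * c8\<bar> \<le> \<bar>y\<bar> * (z^8/40320)"
    unfolding abs_mult c using cos_taylor_bounds by (intro mult_left_mono) auto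
  moreover have "\<bar>y^3/6 * c6\<bar> \<le> \<bar>y\<bar>^3/6 * (z^6/720)"
    unfolding abs_mult c abs_divide power_abs using cos_taylor_bounds by (intro mult_mono) auto
  moreover have "\<bar>y^5/120 * c4\<bar> \<le> \<bar>y\<bar>^5/120 * (z^4/24)"
    unfolding abs_mult c abs_divide power_abs using cos_taylor_bounds by (intro mult_mono) auto
  moreover have "\<bar>y^7/5040 * c2\<bar> \<le> \<bar>y\<bar>^7/5040 * (z^2/2)"
    unfolding abs_mult c abs_divide power_abs using cos_taylor_bounds by (intro mult_mono) auto
  ultimately show ?thesis unfolding eq by linarith
qed

text \<open>
  On this range \<open>t\<^sup>2 \<le> 2.4675\<close>, so the sextic term of the Taylor expansion can be absorbed by lowering the
  quartic coefficient from \<open>1/24\<close> to \<open>19/500 \<le> 1/24 - 2.4675/720\<close>.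
\<close>

lemma cos_ge_quartic:
  fixes t :: real
  assumes "\<bar>t\<bar> \<le> pi/2"
  shows "1 - t^2/2 + 19/500 * t^4 \<le> cos t"
proof -
  have "t^2 \<le> (pi/2)^2"
    using assms by (metis abs_ge_zero power2_abs power_mono)
  also have "\<dots> \<le> (1.5708::real)^2"
    using pi_approx by (intro power_mono) auto
  finally have "19/500 * t^4 \<le> t^4 * (1/24 - t^2/720)"
    by (subst mult.commute, intro mult_left_mono) (auto simp: power2_eq_square)
  also have "\<dots> = t^4/24 - t^6/720" by (simp add: algebra_simps flip: power_add)
  finally show ?thesis using cos_taylor_bounds(3)[of t] by linarith
qed

text \<open>
  Since \<open>2 cos y cos z = cos (y + z) + cos (y - z)\<close>, the quartic bound can be averaged.
\<close>

lemma cos_mult_cos_ge: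
  fixes y z :: real
  assumes "\<bar>y\<bar> + \<bar>z\<bar> \<le> pi/2"
  shows "1 - (y^2 + z^2)/2 + 19/500 * (y^4 + 6 * y^2 * z^2 + z^4) \<le> cos y * cos z"
proof -
  have "1 - (y + z)^2/2 + 19/500 * (y + z)^4 \<le> cos (y + z)"
    "1 - (y - z)^2/2 + 19/500 * (y - z)^4 \<le> cos (y - z)"
    using assms by (intro cos_ge_quartic; linarith)+
  then have "(1 - (y + z)^2/2 + 19/500 * (y + z)^4 + (1 - (y - z)^2/2 + 19/500 * (y - z)^4))/2
     \<le> cos y * cos z"
    by (simp add: cos_add cos_diff)
  moreover have "(1 - (y + z)^2/2 + 19/500 * (y + z)^4 + (1 - (y - z)^2/2 + 19/500 * (y - z)^4))/2
     = 1 - (y^2 + z^2)/2 + 19/500 * (y^4 + 6 * y^2 * z^2 + z^4)"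
    by (simp add: power2_eq_square power4_eq_xxxx field_simps)
  ultimately show ?thesis by linarith
qed

section \<open>The direction integral in symmetric coordinates\<close>

text \<open>
  The even part of the interpolated angle, divided by \<open>a + b\<close>, as a function of \<open>w = (2t - 1)\<^sup>2\<close>. At \<open>e = 0\<close> it is
  half the second Legendre polynomial in \<open>2t - 1\<close>, and \<open>e\<close> carries the cubic correction of the midpoint value.
\<close>

definition profile :: "real \<Rightarrow> real \<Rightarrow> real" where
  "profile e w = (3 * w - 1) / 4 + e * (1 - w)"

lemma profile_affine: "profile e w = (e - 1/4) + (3/4 - e) * w"
  by (simp add: profile_def field_simps)

text \<open>
  The envelope is affine in \<open>w\<close> and independent of \<open>e\<close>, so that the error terms of the expansion integrate to
  numbers.
\<close>

lemma abs_profile_le: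
  assumes "0 \<le> e" "e \<le> 1/2" "0 \<le> w" "w \<le> 1"
  shows "\<bar>profile e w\<bar> \<le> 1/4 + 1/4 * w"
proof -
  have "0 \<le> e * (1 - w)" "e * (1 - w) \<le> 1/2 * (1 - w)"
    using assms by (simp, intro mult_right_mono) auto
  then show ?thesis
    using assms unfolding profile_def abs_le_iff by (intro conjI; simp add: field_simps)
qed

text \<open>
  In the sum and difference of the end values, \<open>1/136 - 1/184 = 3/1564\<close> and \<open>1/136 + 1/184 = 20/1564\<close> are the
  coefficients that the cubic factor of \<open>f_tilde\<close> acquires.
\<close>

lemma quad_interp_f_tilde_profile:
  "quad_interp f_tilde a b t =
     (b - a)/2 * (2*t - 1) + (a + b) * profile ((3 * (a + b)^2 + 20 * (a - b)^2) / 1564) ((2*t - 1)^2)"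
  unfolding quad_interp_def f_tilde_def lagrange_0_def lagrange_half_def lagrange_1_def profile_def
  by (simp add: field_simps power2_eq_square)

text \<open>
  The substitution \<open>t \<mapsto> 1 - t\<close> allows the integrand to be averaged with its reflection.
\<close>

lemma has_integral_reflect_symmetrize:
  fixes f :: "real \<Rightarrow> real"
  assumes "(f has_integral I) {0..1}"
  shows "((\<lambda>t. (f t + f (1 - t)) / 2) has_integral I) {0..1}"
proof -
  have "((\<lambda>t. f (1 - t)) has_integral I) {0..1}"
    using has_integral_affinity01[OF assms, of "-1" 1] by (simp add: image_diff_atLeastAtMost add.commute[of _ 1])
  from has_integral_divide[OF has_integral_add[OF assms this], of 2] show ?thesis by simp
qed

text \<open>
  The reflection changes the sign of the odd part of the angle only, so averaging turns the sine and cosine of the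
  sum into products by the addition theorems.
\<close>

lemma direction_integral_components:
  fixes a b :: real
  defines "e \<equiv> (3 * (a + b)^2 + 20 * (a - b)^2) / 1564"
  defines "Z \<equiv> direction_integral (quad_interp f_tilde a b)"
  shows "((\<lambda>t. sin ((a + b) * profile e ((2*t - 1)^2)) * cos ((b - a)/2 * (2*t - 1))) has_integral Im Z) {0..1}"
    and "((\<lambda>t. cos ((a + b) * profile e ((2*t - 1)^2)) * cos ((b - a)/2 * (2*t - 1))) has_integral Re Z) {0..1}"
proof -
  define g where "g = quad_interp f_tilde a b"
  have g: "g t = (b - a)/2 * (2*t - 1) + (a + b) * profile e ((2*t - 1)^2)" for t
    unfolding g_def e_def by (rule quad_interp_f_tilde_profile)
  have g': "g (1 - t) = - ((b - a)/2 * (2*t - 1)) + (a + b) * profile e ((2*t - 1)^2)" for t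
  proof -
    have "(2 * (1 - t) - 1)^2 = (2*t - 1)^2" by (simp add: power2_eq_square algebra_simps)
    then show ?thesis unfolding g by (simp add: field_simps)
  qed
  have "continuous_on {0..1} (\<lambda>s. exp (\<i> * complex_of_real (g s)))"
    unfolding g_def by (intro continuous_intros quad_interp_continuous)
  then have Z: "((\<lambda>s. exp (\<i> * complex_of_real (g s))) has_integral Z) {0..1}"
    unfolding Z_def direction_integral_def g_def[symmetric]
    by (intro integrable_integral integrable_continuous_real)
  have sin_mean: "(sin (g t) + sin (g (1 - t))) / 2 =
      sin ((a + b) * profile e ((2*t - 1)^2)) * cos ((b - a)/2 * (2*t - 1))" for t
    unfolding g' unfolding g sin_add by simp
  have "((\<lambda>s. sin (g s)) has_integral Im Z) {0..1}"
    using has_integral_linear[OF Z bounded_linear_Im] by (simp add: o_def Im_exp)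
  from has_integral_reflect_symmetrize[OF this]
  show "((\<lambda>t. sin ((a + b) * profile e ((2*t - 1)^2)) * cos ((b - a)/2 * (2*t - 1))) has_integral Im Z) {0..1}"
    unfolding sin_mean .
  have cos_mean: "(cos (g t) + cos (g (1 - t))) / 2 =
      cos ((a + b) * profile e ((2*t - 1)^2)) * cos ((b - a)/2 * (2*t - 1))" for t
    unfolding g' unfolding g cos_add by simp
  have "((\<lambda>s. cos (g s)) has_integral Re Z) {0..1}"
    using has_integral_linear[OF Z bounded_linear_Re] by (simp add: o_def Re_exp)
  from has_integral_reflect_symmetrize[OF this]
  show "((\<lambda>t. cos ((a + b) * profile e ((2*t - 1)^2)) * cos ((b - a)/2 * (2*t - 1))) has_integral Re Z) {0..1}"
    unfolding cos_mean .
qed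

section \<open>Moments of the profile\<close>

lemma has_integral_even_power:
  "((\<lambda>t. ((2*t - 1)^2)^k) has_integral (1 / (2 * real k + 1))) {0..1::real}"
proof -
  have "((\<lambda>t. ((2*t - 1)^2)^k) has_integral
      ((2*1 - 1) ^ (2*k+1) / (2 * (2 * real k + 1)) - (2*0 - 1) ^ (2*k+1) / (2 * (2 * real k + 1)))) {0..1::real}"
  proof (rule fundamental_theorem_of_calculus)
    fix x :: real
    have lin: "((\<lambda>t. 2*t - 1) has_real_derivative 2) (at x within {0..1})"
      by (auto intro!: derivative_eq_intros)
    have quot: "(1 + 2 * real k) * (2 * X) / (4 * real k + 2) = X" for X
      by (simp add: field_simps)
    have "((\<lambda>t. (2*t - 1) ^ (2*k+1) / (2 * (2 * real k + 1))) has_real_derivative ((2*x - 1)^2)^k) (at x within {0..1})"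
      using quot DERIV_cdivide[OF DERIV_power_Suc[OF lin, of "2*k"], of "2 * (2 * real k + 1)"]
      by (simp add: power_mult)
    then show "((\<lambda>t. (2*t - 1) ^ (2*k+1) / (2 * (2 * real k + 1))) has_vector_derivative ((2*x - 1)^2)^k) (at x within {0..1})"
      by (simp add: has_real_derivative_iff_has_vector_derivative)
  qed simp
  moreover have "(2*1 - 1) ^ (2*k+1) / (2 * (2 * real k + 1)) - (2*0 - 1) ^ (2*k+1) / (2 * (2 * real k + 1))
      = 1 / (2 * real k + 1)"
    by (simp add: divide_simps)
  ultimately show ?thesis by (simp only:)
qed

definition affine_moment :: "real \<Rightarrow> real \<Rightarrow> nat \<Rightarrow> nat \<Rightarrow> real" where
  "affine_moment a c n l =
     (\<Sum>i\<le>n. of_nat (n choose i) * c^i * a^(n - i) * (1 / (2 * real (i + l) + 1)))"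

text \<open>
  Binomial expansion reduces the integral to those of even powers of \<open>2t - 1\<close>.
\<close>

lemma has_integral_affine_power:
  "((\<lambda>t. (a + c * (2*t - 1)^2)^n * ((2*t - 1)^2)^l) has_integral affine_moment a c n l) {0..1::real}"
proof -
  have expand: "(a + c * v)^n * v^l = (\<Sum>i\<le>n. of_nat (n choose i) * c^i * a^(n - i) * v^(i + l))" for v :: real
    by (subst add.commute, subst binomial_ring)
      (simp add: sum_distrib_left power_mult_distrib power_add algebra_simps)
  show ?thesis
    unfolding expand affine_moment_def
    by (intro has_integral_sum finite_atMost has_integral_mult_right has_integral_even_power)
qed

definition profile_moment :: "real \<Rightarrow> nat \<Rightarrow> nat \<Rightarrow> real" where
  "profile_moment e = affine_moment (e - 1/4) (3/4 - e)"

lemma has_integral_profile_moment: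
  "((\<lambda>t. profile e ((2*t - 1)^2)^n * ((2*t - 1)^2)^l) has_integral profile_moment e n l) {0..1}"
  unfolding profile_affine profile_moment_def by (rule has_integral_affine_power)

text \<open>
  Unrolling the sums for indeterminate \<open>a\<close> and \<open>c\<close> keeps the expressions small; substituting the coefficients of
  the profile is then a ring identity in \<open>e\<close>.
\<close>

lemma affine_moment_values:
  shows "affine_moment a c 1 0 = a + 1/3 * c"
    and "affine_moment a c 1 1 = 1/3 * a + 1/5 * c"
    and "affine_moment a c 1 2 = 1/5 * a + 1/7 * c"
    and "affine_moment a c 1 3 = 1/7 * a + 1/9 * c"
    and "affine_moment a c 3 0 = a^3 + c * a^2 + 3/5 * c^2 * a + 1/7 * c^3"
    and "affine_moment a c 3 1 = 1/3 * a^3 + 3/5 * c * a^2 + 3/7 * c^2 * a + 1/9 * c^3"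
    and "affine_moment a c 3 2 = 1/5 * a^3 + 3/7 * c * a^2 + 1/3 * c^2 * a + 1/11 * c^3"
    and "affine_moment a c 5 0 = a^5 + 5/3 * c * a^4 + 2 * c^2 * a^3 + 10/7 * c^3 * a^2 + 5/9 * c^4 * a + 1/11 * c^5"
    and "affine_moment a c 5 1 = 1/3 * a^5 + c * a^4 + 10/7 * c^2 * a^3 + 10/9 * c^3 * a^2 + 5/11 * c^4 * a + 1/13 * c^5"
    and "affine_moment a c 7 0 = a^7 + 7/3 * c * a^6 + 21/5 * c^2 * a^5 + 5 * c^3 * a^4 + 35/9 * c^4 * a^3 + 21/11 * c^5 * a^2 + 7/13 * c^6 * a + 1/15 * c^7"
    and "affine_moment a c 2 0 = a^2 + 2/3 * c * a + 1/5 * c^2"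
    and "affine_moment a c 2 1 = 1/3 * a^2 + 2/5 * c * a + 1/7 * c^2"
    and "affine_moment a c 4 0 = a^4 + 4/3 * c * a^3 + 6/5 * c^2 * a^2 + 4/7 * c^3 * a + 1/9 * c^4"
  unfolding affine_moment_def
  by (simp_all add: atMost_nat_numeral binomial_fact fact_numeral mult_ac)

lemma profile_moment_values:
  shows "profile_moment e 1 0 = 2/3 * e"
    and "profile_moment e 1 1 = 1/15 + 2/15 * e"
    and "profile_moment e 1 2 = 2/35 + 2/35 * e"
    and "profile_moment e 1 3 = 1/21 + 2/63 * e"
    and "profile_moment e 3 0 = 1/140 + 1/14 * e - 8/35 * e^2 + 16/35 * e^3"
    and "profile_moment e 3 1 = 1/105 + 1/70 * e + 16/315 * e^3"
    and "profile_moment e 3 2 = 13/1540 + 1/110 * e + 8/1155 * e^2 + 16/1155 * e^3"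
    and "profile_moment e 5 0 = 1/616 + 13/1848 * e - 8/231 * e^2 + 40/231 * e^3 - 256/693 * e^4 + 256/693 * e^5"
    and "profile_moment e 5 1 = 79/48048 + 53/24024 * e + 4/3003 * e^2 + 8/819 * e^3 - 128/9009 * e^4 + 256/9009 * e^5"
    and "profile_moment e 7 0 = 3/9152 + 1/1248 * e - 1/286 * e^2 + 1/33 * e^3 - 160/1287 * e^4 + 64/195 * e^5 - 1024/2145 * e^6 + 2048/6435 * e^7"
    and "profile_moment e 2 0 = 1/20 - 2/15 * e + 8/15 * e^2"
    and "profile_moment e 2 1 = 11/420 + 2/105 * e + 8/105 * e^2"
    and "profile_moment e 4 0 = 3/560 - 1/105 * e + 4/35 * e^2 - 32/105 * e^3 + 128/315 * e^4"
  unfolding profile_moment_def affine_moment_values by algebra+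

text \<open>
  Moments of the envelope \<open>(1 + w) / 4\<close> of the profile, rounded upwards.
\<close>

lemma envelope_moment_bounds:
  shows "affine_moment (1/4) (1/4) 1 4 \<le> 50506/1000000"
    and "affine_moment (1/4) (1/4) 3 3 \<le> 12904/1000000"
    and "affine_moment (1/4) (1/4) 5 2 \<le> 3307/1000000"
    and "affine_moment (1/4) (1/4) 7 1 \<le> 85116/100000000"
    and "affine_moment (1/4) (1/4) 9 0 \<le> 22163/100000000"
  unfolding affine_moment_def
  by (simp_all add: atMost_nat_numeral binomial_fact fact_numeral power_divide)

section \<open>Integrated Taylor expansions\<close>

text \<open>
  The Taylor polynomial of \<open>sin (s h) cos (d u / 2)\<close>, integrated over the unit interval and divided by \<open>s\<close>, with
  \<open>p = s\<^sup>2\<close> and \<open>q = d\<^sup>2\<close>. The moments of \<open>h, h\<^sup>3, h\<^sup>5, h\<^sup>7\<close> appear in turn; the coefficient at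
  \<open>p\<^sup>j q\<^sup>k\<close> is \<open>\<plusminus> 1 / ((2j + 1)! (2k)! 4\<^sup>k)\<close>.
\<close>

definition im_main :: "real \<Rightarrow> real \<Rightarrow> real \<Rightarrow> real" where
  "im_main p q e =
     profile_moment e 1 0 - q/8 * profile_moment e 1 1 + q^2/384 * profile_moment e 1 2
       - q^3/46080 * profile_moment e 1 3
     - p/6 * profile_moment e 3 0 + p * q/48 * profile_moment e 3 1
       - p * q^2/2304 * profile_moment e 3 2
     + p^2/120 * profile_moment e 5 0 - p^2 * q/960 * profile_moment e 5 1
     - p^3/5040 * profile_moment e 7 0"

text \<open>
  A bound, quartic in the squared coordinates, for the integrated Taylor error divided by \<open>s\<close>; the coefficients
  are those of \<open>sin_mult_cos_taylor\<close> times the moments of the envelope, rounded upwards.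
\<close>

definition im_tail :: "real \<Rightarrow> real \<Rightarrow> real" where
  "im_tail p q =
     49/10000000000 * q^4 + 467/10000000000 * p * q^3 + 718/10000000000 * p^2 * q^2 + 212/10000000000 * p^3 * q + 62/100000000000 * p^4"

text \<open>
  The expansion of \<open>sin y cos z\<close> at \<open>y = s h\<close> and \<open>z = d v / 2\<close>, sorted into moments of the profile. In the error
  the profile is replaced by its envelope \<open>m\<close>.
\<close>

lemma sin_profile_cos_pointwise:
  fixes s d v e :: real
  defines "p \<equiv> s^2" and "q \<equiv> d^2" and "w \<equiv> v^2"
  defines "h \<equiv> profile e w" and "m \<equiv> 1/4 + 1/4 * w"
  assumes s: "0 \<le> s" and e: "0 \<le> e" "e \<le> 1/2" and w: "w \<le> 1"
  shows "\<bar>sin (s * h) * cos (d/2 * v)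
      - s * (h - q/8 * (h * w) + q^2/384 * (h * w^2) - q^3/46080 * (h * w^3)
          - p/6 * h^3 + p * q/48 * (h^3 * w) - p * q^2/2304 * (h^3 * w^2)
          + p^2/120 * h^5 - p^2 * q/960 * (h^5 * w) - p^3/5040 * h^7)\<bar>
     \<le> s * (q^4/10321920 * (m * w^4) + p * q^3/276480 * (m^3 * w^3) + p^2 * q^2/46080 * (m^5 * w^2)
          + p^3 * q/40320 * (m^7 * w) + p^4/362880 * m^9)"
proof -
  define y where "y = s * h"
  define z where "z = d/2 * v"
  have w0: "0 \<le> w" unfolding w_def by simp
  have hm: "\<bar>h\<bar> \<le> m"
    unfolding h_def m_def by (rule abs_profile_le[OF e w0 w])
  have ym: "\<bar>y\<bar>^n \<le> (s * m)^n" for n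
    using hm s unfolding y_def by (intro power_mono) (auto simp: abs_mult mult_left_mono)
  have z2: "z^2 = q * w / 4"
    unfolding z_def q_def w_def by (simp add: power_mult_distrib power_divide)
  have zk: "z^4 = (q * w / 4)^2" "z^6 = (q * w / 4)^3" "z^8 = (q * w / 4)^4"
    by (simp_all flip: z2 power_mult)
  have sk: "s^3 = s * p" "s^5 = s * p^2" "s^7 = s * p^3" "s^9 = s * p^4"
    unfolding p_def by (simp_all flip: power_mult power_Suc)
  have main: "y * (1 - z^2/2 + z^4/24 - z^6/720) - y^3/6 * (1 - z^2/2 + z^4/24)
             + y^5/120 * (1 - z^2/2) - y^7/5040
     = s * (h - q/8 * (h * w) + q^2/384 * (h * w^2) - q^3/46080 * (h * w^3)
          - p/6 * h^3 + p * q/48 * (h^3 * w) - p * q^2/2304 * (h^3 * w^2)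
          + p^2/120 * h^5 - p^2 * q/960 * (h^5 * w) - p^3/5040 * h^7)"
    unfolding y_def z2 zk power_mult_distrib sk by (simp add: field_simps)
  have "\<bar>y\<bar>^1 * (z^8/40320) + \<bar>y\<bar>^3/6 * (z^6/720) + \<bar>y\<bar>^5/120 * (z^4/24)
        + \<bar>y\<bar>^7/5040 * (z^2/2) + \<bar>y\<bar>^9/362880
     \<le> (s * m)^1 * (z^8/40320) + (s * m)^3/6 * (z^6/720) + (s * m)^5/120 * (z^4/24)
        + (s * m)^7/5040 * (z^2/2) + (s * m)^9/362880"
    by (intro add_mono mult_right_mono divide_right_mono ym) (auto simp: zero_le_even_power)
  also have "\<dots> = s * (q^4/10321920 * (m * w^4) + p * q^3/276480 * (m^3 * w^3) + p^2 * q^2/46080 * (m^5 * w^2)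
          + p^3 * q/40320 * (m^7 * w) + p^4/362880 * m^9)"
    unfolding z2 zk power_mult_distrib sk by (simp add: field_simps)
  finally show ?thesis
    using sin_mult_cos_taylor[of y z, unfolded main] unfolding y_def[symmetric] z_def[symmetric] by simp
qed

lemma sin_integral_bounds:
  fixes s d e :: real
  assumes s: "0 \<le> s" and e: "0 \<le> e" "e \<le> 1/2"
    and I: "((\<lambda>t. sin (s * profile e ((2*t - 1)^2)) * cos (d/2 * (2*t - 1))) has_integral I) {0..1}"
  shows "\<bar>I - s * im_main (s^2) (d^2) e\<bar> \<le> s * im_tail (s^2) (d^2)"
proof -
  define p q where "p = s^2" and "q = d^2"
  have pq: "0 \<le> p" "0 \<le> q" unfolding p_def q_def by auto
  define P where "P t = profile e ((2*t - 1)^2)^1 * ((2*t - 1)^2)^0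
      - q/8 * (profile e ((2*t - 1)^2)^1 * ((2*t - 1)^2)^1)
      + q^2/384 * (profile e ((2*t - 1)^2)^1 * ((2*t - 1)^2)^2)
      - q^3/46080 * (profile e ((2*t - 1)^2)^1 * ((2*t - 1)^2)^3)
      - p/6 * (profile e ((2*t - 1)^2)^3 * ((2*t - 1)^2)^0)
      + p * q/48 * (profile e ((2*t - 1)^2)^3 * ((2*t - 1)^2)^1)
      - p * q^2/2304 * (profile e ((2*t - 1)^2)^3 * ((2*t - 1)^2)^2)
      + p^2/120 * (profile e ((2*t - 1)^2)^5 * ((2*t - 1)^2)^0)
      - p^2 * q/960 * (profile e ((2*t - 1)^2)^5 * ((2*t - 1)^2)^1)
      - p^3/5040 * (profile e ((2*t - 1)^2)^7 * ((2*t - 1)^2)^0)" for t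
  define E where "E t = q^4/10321920 * ((1/4 + 1/4 * (2*t - 1)^2)^1 * ((2*t - 1)^2)^4)
      + p * q^3/276480 * ((1/4 + 1/4 * (2*t - 1)^2)^3 * ((2*t - 1)^2)^3)
      + p^2 * q^2/46080 * ((1/4 + 1/4 * (2*t - 1)^2)^5 * ((2*t - 1)^2)^2)
      + p^3 * q/40320 * ((1/4 + 1/4 * (2*t - 1)^2)^7 * ((2*t - 1)^2)^1)
      + p^4/362880 * ((1/4 + 1/4 * (2*t - 1)^2)^9 * ((2*t - 1)^2)^0)" for t :: real
  define T where "T = q^4/10321920 * affine_moment (1/4) (1/4) 1 4
      + p * q^3/276480 * affine_moment (1/4) (1/4) 3 3
      + p^2 * q^2/46080 * affine_moment (1/4) (1/4) 5 2
      + p^3 * q/40320 * affine_moment (1/4) (1/4) 7 1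
      + p^4/362880 * affine_moment (1/4) (1/4) 9 0"
  have P: "(P has_integral im_main p q e) {0..1}"
    unfolding P_def im_main_def
    by (intro has_integral_add has_integral_diff has_integral_mult_right has_integral_profile_moment)
  have E: "(E has_integral T) {0..1}"
    unfolding E_def T_def by (intro has_integral_add has_integral_mult_right has_integral_affine_power)
  have pointwise: "\<bar>sin (s * profile e ((2*t - 1)^2)) * cos (d/2 * (2*t - 1)) - s * P t\<bar> \<le> s * E t"
    if "t \<in> {0..1}" for t
  proof -
    have "(2*t - 1)^2 \<le> 1"
      using that by (simp add: abs_square_le_1 abs_le_iff)
    then show ?thesis
      using sin_profile_cos_pointwise[OF s e, of "2*t - 1" d]
      unfolding P_def E_def p_def q_def by simp
  qed
  have "I \<le> s * im_main p q e + s * T"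
    using pointwise
    by (intro has_integral_le[OF I has_integral_add[OF has_integral_mult_right[OF P] has_integral_mult_right[OF E]]])
      (fastforce simp: abs_le_iff)
  moreover have "s * im_main p q e - s * T \<le> I"
    using pointwise
    by (intro has_integral_le[OF has_integral_diff[OF has_integral_mult_right[OF P] has_integral_mult_right[OF E]] I])
      (fastforce simp: abs_le_iff)
  moreover have "T \<le> im_tail p q"
  proof -
    have "T \<le> q^4/10321920 * (50506/1000000) + p * q^3/276480 * (12904/1000000) + p^2 * q^2/46080 * (3307/1000000)
      + p^3 * q/40320 * (85116/100000000) + p^4/362880 * (22163/100000000)"
      unfolding T_def using pq
      by (intro add_mono mult_left_mono envelope_moment_bounds) auto
    also have "\<dots> \<le> 49/10000000000 * q^4 + 467/10000000000 * (p * q^3) + 718/10000000000 * (p^2 * q^2)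
      + 212/10000000000 * (p^3 * q) + 62/100000000000 * p^4"
      using pq by (intro add_mono) (auto simp: field_simps)
    finally show ?thesis unfolding im_tail_def by (simp add: mult.assoc)
  qed
  ultimately show ?thesis
    using mult_left_mono[of T "im_tail p q" s] s unfolding p_def q_def by linarith
qed

text \<open>
  The integral of the quartic lower bound for \<open>cos (s h) cos (d u / 2)\<close>.
\<close>

definition re_main :: "real \<Rightarrow> real \<Rightarrow> real \<Rightarrow> real" where
  "re_main p q e = 1 - p/2 * profile_moment e 2 0 - q/24
     + 19/500 * (p^2 * profile_moment e 4 0 + 3/2 * p * q * profile_moment e 2 1 + q^2/80)"

lemma cos_integral_lower_bound:
  fixes s d e :: real
  assumes s: "0 \<le> s" and sd: "s + \<bar>d\<bar> \<le> pi" and e: "0 \<le> e" "e \<le> 1/2"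
    and I: "((\<lambda>t. cos (s * profile e ((2*t - 1)^2)) * cos (d/2 * (2*t - 1))) has_integral I) {0..1}"
  shows "re_main (s^2) (d^2) e \<le> I"
proof -
  define p q where "p = s^2" and "q = d^2"
  define P where "P t = 1
      - p/2 * (profile e ((2*t - 1)^2)^2 * ((2*t - 1)^2)^0)
      - q/8 * ((2*t - 1)^2)^1
      + 19/500 * (p^2 * (profile e ((2*t - 1)^2)^4 * ((2*t - 1)^2)^0)
        + 3/2 * p * q * (profile e ((2*t - 1)^2)^2 * ((2*t - 1)^2)^1)
        + q^2/16 * ((2*t - 1)^2)^2)" for t
  have "(P has_integral (1 - p/2 * profile_moment e 2 0 - q/8 * (1 / (2 * real 1 + 1))
     + 19/500 * (p^2 * profile_moment e 4 0 + 3/2 * p * q * profile_moment e 2 1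
        + q^2/16 * (1 / (2 * real 2 + 1))))) {0..1}"
    unfolding P_def using has_integral_const_real[of "1::real" 0 1]
    by (intro has_integral_add has_integral_diff has_integral_mult_right has_integral_profile_moment
        has_integral_even_power) simp
  then have P: "(P has_integral re_main p q e) {0..1}"
    unfolding re_main_def by simp
  have "P t \<le> cos (s * profile e ((2*t - 1)^2)) * cos (d/2 * (2*t - 1))"
    if t: "t \<in> {0..1}" for t
  proof -
    define w where "w = (2*t - 1)^2"
    define h where "h = profile e w"
    have w: "0 \<le> w" "w \<le> 1" and v: "\<bar>2*t - 1\<bar> \<le> 1"
      using t by (auto simp: w_def abs_square_le_1 abs_le_iff)
    have "\<bar>h\<bar> \<le> 1/2"
      using abs_profile_le[OF e w] w unfolding h_def by linarith
    then have "\<bar>s * h\<bar> \<le> s * (1/2)"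
      using s by (simp only: abs_mult abs_of_nonneg mult_left_mono)
    moreover have "\<bar>d/2 * (2*t - 1)\<bar> \<le> \<bar>d\<bar>/2 * 1"
      unfolding abs_mult using v by (intro mult_mono) auto
    ultimately have "\<bar>s * h\<bar> + \<bar>d/2 * (2*t - 1)\<bar> \<le> pi/2"
      using sd by linarith
    from cos_mult_cos_ge[OF this]
    have "1 - ((s * h)^2 + (d/2 * (2*t - 1))^2)/2 + 19/500 * ((s * h)^4
       + 6 * (s * h)^2 * (d/2 * (2*t - 1))^2 + (d/2 * (2*t - 1))^4)
       \<le> cos (s * h) * cos (d/2 * (2*t - 1))" .
    moreover have z2: "(d/2 * (2*t - 1))^2 = q * w / 4"
      unfolding w_def q_def by (simp add: power_mult_distrib power_divide)
    have z4: "(d/2 * (2*t - 1))^4 = (q * w / 4)^2"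
      by (simp flip: z2 power_mult)
    have y: "(s * h)^2 = p * h^2" "(s * h)^4 = p^2 * h^4"
      unfolding p_def by (simp_all add: power_mult_distrib flip: power_mult)
    moreover have "P t = 1 - (p * h^2 + q * w / 4)/2 + 19/500 * (p^2 * h^4 + 6 * (p * h^2) * (q * w / 4) + (q * w / 4)^2)"
      unfolding P_def w_def[symmetric] h_def[symmetric] by (simp add: field_simps)
    ultimately show ?thesis
      unfolding w_def[symmetric] h_def[symmetric] y z4 z2 by simp
  qed
  then show ?thesis
    using has_integral_le[OF P I] unfolding p_def q_def by blast
qed

section \<open>Polynomial enclosures in the squared coordinates\<close>

text \<open>
  The three polynomials below enclose \<open>Im I / s\<close> and bound \<open>Re I\<close>. Their coefficients are those of the Taylor
  expansions in \<open>p\<close> and \<open>q\<close> up to degree three (for the real part, two), moved in the safe direction far enough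
  to absorb all discarded terms. The unit \<open>10\<^sup>-\<^sup>6\<close> makes their sizes visible next to \<open>10\<^sup>6 / 800 = 1250\<close>.
\<close>

definition im_upper :: "real \<Rightarrow> real \<Rightarrow> real" where
  "im_upper p q = (192 * q - 64 * q^2 + 92/100 * q^3 + 883/10 * p + 147/10 * (p * q) + 7 * (p * q^2)
     - 917/100 * p^2 + 153/100 * (p^2 * q) + 194/1000 * p^3) / 1000000"

definition im_lower :: "real \<Rightarrow> real \<Rightarrow> real" where
  "im_lower p q = (1918/10 * q - 647/10 * q^2 + 725/1000 * q^3 + 882/10 * p + 137/10 * (p * q) - 406/100 * (p * q^2)
     - 95/10 * p^2 - 21/10 * (p^2 * q) - 106/1000 * p^3) / 1000000"

definition re_lower :: "real \<Rightarrow> real \<Rightarrow> real" where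
  "re_lower p q = 1 - q/24 - p/40 + 475/1000000 * q^2 + 189/100000 * (p * q) + 215/1000000 * p^2"

text \<open>
  The quartic error is lowered to cubic degree. On the triangle \<open>p + q \<le> (s + d)\<^sup>2 \<le> pi\<^sup>2 < 9.87\<close>, and
  \<open>p q = (s d)\<^sup>2 \<le> (pi\<^sup>2 / 4)\<^sup>2 < 6.1\<close>, which is much sharper than the product of the separate bounds and keeps the
  mixed terms small.
\<close>

lemma im_tail_le:
  assumes pq: "0 \<le> p" "0 \<le> q" "p + q \<le> 987/100" "p * q \<le> 61/10"
  shows "im_tail p q \<le> (484/10000 * q^3 + 285/1000 * q^2 + 439/1000 * (p * q) + 13/100 * p^2 + 62/10000 * p^3) / 1000000"
proof -
  have "q * q^3 \<le> 987/100 * q^3" "p * p^3 \<le> 987/100 * p^3"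
    "(p * q) * q^2 \<le> 61/10 * q^2" "(p * q) * (p * q) \<le> 61/10 * (p * q)" "(p * q) * p^2 \<le> 61/10 * p^2"
    using pq by (intro mult_right_mono; simp)+
  moreover have "q * q^3 = q^4" "p * p^3 = p^4" "(p * q) * q^2 = p * q^3"
    "(p * q) * (p * q) = p^2 * q^2" "(p * q) * p^2 = p^3 * q"
    by (simp_all add: power2_eq_square power3_eq_cube power4_eq_xxxx)
  ultimately have "q^4 \<le> 987/100 * q^3" "p^4 \<le> 987/100 * p^3" "p * q^3 \<le> 61/10 * q^2"
    "p^2 * q^2 \<le> 61/10 * (p * q)" "p^3 * q \<le> 61/10 * p^2"
    by (simp_all only:)
  moreover have "0 \<le> q^3" "0 \<le> q^2" "0 \<le> p * q" "0 \<le> p^2" "0 \<le> p^3"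
    using pq by auto
  ultimately show ?thesis
    unfolding im_tail_def mult.assoc by argo
qed

text \<open>
  Where accuracy matters, the part of the expansion in \<open>e\<close> is kept that contributes to degree at most three in the
  squared coordinates, with \<open>e\<close> itself counting as degree one; elsewhere a constant is enough.
  The range of \<open>e\<close> corresponds to \<open>p + q \<le> 9.87\<close>.
\<close>

lemma profile_moment_bounds:
  assumes e: "0 \<le> e" "e \<le> 127/1000"
  shows "1/21 \<le> profile_moment e 1 3" "profile_moment e 1 3 \<le> 52/1000"
    and "1/140 + e/14 - 8/35 * e^2 \<le> profile_moment e 3 0" "profile_moment e 3 0 \<le> 1/140 + e/14"
    and "1/105 \<le> profile_moment e 3 1" "profile_moment e 3 1 \<le> 1/105 + e/65"
    and "13/1540 \<le> profile_moment e 3 2" "profile_moment e 3 2 \<le> 1/100"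
    and "1/616 \<le> profile_moment e 5 0" "profile_moment e 5 0 \<le> 1/616 + 13/1848 * e"
    and "79/48048 \<le> profile_moment e 5 1" "profile_moment e 5 1 \<le> 2/1000"
    and "3/9152 \<le> profile_moment e 7 0" "profile_moment e 7 0 \<le> 5/10000"
    and "profile_moment e 2 0 \<le> 1/20 - e/16"
    and "11/420 \<le> profile_moment e 2 1"
    and "41/10000 \<le> profile_moment e 4 0"
proof -
  have pos: "0 \<le> e^n" for n
    using e by simp
  have "e^Suc n \<le> 127/1000 * e^n" for n
    unfolding power_Suc using e by (intro mult_right_mono) auto
  from this[of 1] this[of 2] this[of 3] this[of 4] this[of 5] this[of 6]
  have step: "e^2 \<le> 127/1000 * e" "e^3 \<le> 127/1000 * e^2" "e^4 \<le> 127/1000 * e^3" "e^5 \<le> 127/1000 * e^4"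
    "e^6 \<le> 127/1000 * e^5" "e^7 \<le> 127/1000 * e^6"
    by (simp_all add: eval_nat_numeral)
  note facts = e step pos[of 2] pos[of 3] pos[of 4] pos[of 5] pos[of 6] pos[of 7]
  show "1/21 \<le> profile_moment e 1 3" "profile_moment e 1 3 \<le> 52/1000"
    "1/140 + e/14 - 8/35 * e^2 \<le> profile_moment e 3 0" "profile_moment e 3 0 \<le> 1/140 + e/14"
    "1/105 \<le> profile_moment e 3 1" "profile_moment e 3 1 \<le> 1/105 + e/65"
    "13/1540 \<le> profile_moment e 3 2" "profile_moment e 3 2 \<le> 1/100"
    "1/616 \<le> profile_moment e 5 0" "profile_moment e 5 0 \<le> 1/616 + 13/1848 * e"
    "79/48048 \<le> profile_moment e 5 1" "profile_moment e 5 1 \<le> 2/1000"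
    "3/9152 \<le> profile_moment e 7 0" "profile_moment e 7 0 \<le> 5/10000"
    "profile_moment e 2 0 \<le> 1/20 - e/16"
    "11/420 \<le> profile_moment e 2 1"
    "41/10000 \<le> profile_moment e 4 0"
    unfolding profile_moment_values using facts by argo+
qed

text \<open>
  From here on the parameter of the profile is the one produced by \<open>f_tilde\<close>.
\<close>

context
  fixes p q e :: real
  assumes pq: "0 \<le> p" "0 \<le> q" "p + q \<le> 987/100" "p * q \<le> 61/10"
    and e_eq: "e = (3 * p + 20 * q) / 1564"
begin

lemma profile_parameter_bounds: "0 \<le> e" "e \<le> 127/1000"
  using pq unfolding e_eq by auto

lemma squared_coordinate_monomials_nonneg:
  "0 \<le> p * q" "0 \<le> p^2" "0 \<le> q^2" "0 \<le> p * q^2" "0 \<le> p^2 * q" "0 \<le> p^3" "0 \<le> q^3"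
  using pq by auto

lemma profile_parameter_products:
  "p * e = (3 * p^2 + 20 * (p * q)) / 1564" "q * e = (3 * (p * q) + 20 * q^2) / 1564"
  "q^2 * e = (3 * (p * q^2) + 20 * q^3) / 1564" "p * q * e = (3 * (p^2 * q) + 20 * (p * q^2)) / 1564"
  "p^2 * e = (3 * p^3 + 20 * (p^2 * q)) / 1564"
  "p * e^2 = (9 * p^3 + 120 * (p^2 * q) + 400 * (p * q^2)) / 2446096"
  unfolding e_eq by (simp_all add: field_simps power2_eq_square power3_eq_cube)

lemma im_main_plus_tail_le: "im_main p q e + im_tail p q \<le> im_upper p q"
proof -
  have "im_main p q e \<le> 2/3 * e - q/8 * (1/15 + 2/15 * e) + q^2/384 * (2/35 + 2/35 * e) - q^3/46080 * (1/21)
     - p/6 * (1/140 + e/14 - 8/35 * e^2) + p * q/48 * (1/105 + e/65) - p * q^2/2304 * (13/1540)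
     + p^2/120 * (1/616 + 13/1848 * e) - p^2 * q/960 * (79/48048) - p^3/5040 * (3/9152)"
    unfolding im_main_def using pq squared_coordinate_monomials_nonneg
    by (intro add_mono diff_mono mult_left_mono profile_moment_bounds[OF profile_parameter_bounds])
      (simp_all add: profile_moment_values del: One_nat_def)
  also have "\<dots> = 2/3 * e - q/120 - (q * e)/60 + (q^2 + q^2 * e)/6720 - q^3/967680
     - p/840 - (p * e)/84 + 4/105 * (p * e^2) + (p * q)/5040 + (p * q * e)/3120
     - 13/3548160 * (p * q^2) + p^2/73920 + 13/221760 * (p^2 * e)
     - 79/46126080 * (p^2 * q) - p^3/15375360"
    by (simp add: field_simps)
  finally show ?thesis
    using im_tail_le[OF pq] squared_coordinate_monomials_nonneg pq unfolding im_upper_def profile_parameter_products unfolding e_eq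
    by argo
qed

lemma im_lower_le: "im_lower p q \<le> im_main p q e - im_tail p q"
proof -
  have "2/3 * e - q/8 * (1/15 + 2/15 * e) + q^2/384 * (2/35 + 2/35 * e) - q^3/46080 * (52/1000)
     - p/6 * (1/140 + e/14) + p * q/48 * (1/105) - p * q^2/2304 * (1/100)
     + p^2/120 * (1/616) - p^2 * q/960 * (2/1000) - p^3/5040 * (5/10000) \<le> im_main p q e"
    unfolding im_main_def using pq squared_coordinate_monomials_nonneg
    by (intro add_mono diff_mono mult_left_mono profile_moment_bounds[OF profile_parameter_bounds])
      (simp_all add: profile_moment_values del: One_nat_def)
  moreover have "2/3 * e - q/8 * (1/15 + 2/15 * e) + q^2/384 * (2/35 + 2/35 * e) - q^3/46080 * (52/1000)
     - p/6 * (1/140 + e/14) + p * q/48 * (1/105) - p * q^2/2304 * (1/100)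
     + p^2/120 * (1/616) - p^2 * q/960 * (2/1000) - p^3/5040 * (5/10000)
     = 2/3 * e - q/120 - (q * e)/60 + (q^2 + q^2 * e)/6720 - 13/11520000 * q^3
     - p/840 - (p * e)/84 + (p * q)/5040 - (p * q^2)/230400
     + p^2/73920 - (p^2 * q)/480000 - p^3/10080000"
    by (simp add: field_simps)
  ultimately show ?thesis
    using im_tail_le[OF pq] squared_coordinate_monomials_nonneg pq unfolding im_lower_def profile_parameter_products unfolding e_eq
    by argo
qed

lemma re_lower_le: "re_lower p q \<le> re_main p q e"
proof -
  have "1 - p/2 * (1/20 - e/16) - q/24 + 19/500 * (p^2 * (41/10000) + 3/2 * p * q * (11/420) + q^2/80)
      \<le> re_main p q e"
    unfolding re_main_def using pq squared_coordinate_monomials_nonneg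
    by (intro add_mono diff_mono mult_left_mono profile_moment_bounds[OF profile_parameter_bounds]) (simp_all add: mult.assoc)
  moreover have "re_lower p q \<le> 1 - p/2 * (1/20 - e/16) - q/24 + 19/500 * (p^2 * (41/10000) + 3/2 * p * q * (11/420) + q^2/80)"
    unfolding re_lower_def e_eq using squared_coordinate_monomials_nonneg
    by (simp add: field_simps power2_eq_square)
  ultimately show ?thesis by linarith
qed

end

text \<open>
  Two affine lower bounds: dropping the quadratic part is enough where there is room, and the second one replaces
  \<open>q\<^sup>2\<close> by its tangent at \<open>q = 9.13\<close>, which is sharper for large \<open>q\<close>.
\<close>

lemma re_lower_ge:
  assumes pq: "0 \<le> p" "0 \<le> q"
  shows "1 - q/24 - p/40 \<le> re_lower p q"
    and "96/100 - 33/1000 * q - p/40 \<le> re_lower p q"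
proof -
  have "0 \<le> (q - 913/100)^2" by simp
  then have "1826/100 * q - 833569/10000 \<le> q^2" by (simp add: power2_eq_square algebra_simps)
  then show "1 - q/24 - p/40 \<le> re_lower p q" "96/100 - 33/1000 * q - p/40 \<le> re_lower p q"
    unfolding re_lower_def using mult_nonneg_nonneg[OF pq] zero_le_power2[of p] zero_le_power2[of q] pq
    by argo+
qed

section \<open>The four polynomial inequalities\<close>

text \<open>
  The linear coefficients \<open>433\<close> and \<open>536.7\<close> of the difference dominate. The largest negative term is the mixed
  one, \<open>-56.4 p q\<close>, and since \<open>p + q \<le> 9.87\<close> one of the two factors is small enough for the linear terms to absorb
  it.
\<close>

lemma im_upper_le_proportional:
  assumes pq: "0 \<le> p" "0 \<le> q" "p + q \<le> 987/100" "p * q \<le> 61/10"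
  shows "im_upper p q \<le> (p + q)/1600 * re_lower p q"
proof -
  have mono: "q * q^2 \<le> 987/100 * q^2" "(p * q) * q \<le> 61/10 * q" "(p * q) * p \<le> 61/10 * p"
    "p * p^2 \<le> 987/100 * p^2" "p * p \<le> 987/100 * p"
    using pq by (intro mult_right_mono; simp)+
  have "0 \<le> 399 * q + 465 * p - 5637/100 * (p * q)"
  proof (cases "p \<le> 6")
    case True
    then have "p * q \<le> 6 * q" using pq by (intro mult_right_mono)
    then show ?thesis using pq by argo
  next
    case False
    then have "p * q \<le> p * (387/100)" using pq by (intro mult_left_mono) auto
    then show ?thesis using pq by argo
  qed
  then have "0 \<le> 433 * q + (64 - 625/24) * q^2 - 623125/1000000 * (q * q^2) + 5367/10 * p
    - (56 + 11/30) * (p * q) - 6455/1000 * (p * p) - 5521875/1000000 * ((p * q) * q)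
    - 214375/1000000 * ((p * q) * p) - 59625/1000000 * (p * p^2)"
    using mono pq zero_le_power2[of q] mult_nonneg_nonneg[OF pq(1,2)] unfolding power2_eq_square[of p] by argo
  also have "\<dots> = 1000000 * ((p + q)/1600 * re_lower p q - im_upper p q)"
    unfolding im_upper_def re_lower_def by (simp add: field_simps power2_eq_square power3_eq_cube)
  finally show ?thesis by (simp add: field_simps)
qed

text \<open>
  The difference is \<open>q A + p B\<close> with \<open>A\<close> and \<open>B\<close> nonnegative. Close to equality is the corner \<open>p = 0\<close>,
  \<open>q = 9.87\<close>, where \<open>a + b\<close> vanishes and \<open>b - a = pi\<close>; there \<open>A\<close> is less than three percent of its value at the
  origin.
\<close>

lemma minus_im_lower_le_proportional:
  assumes pq: "0 \<le> p" "0 \<le> q" "p + q \<le> 987/100" "p * q \<le> 61/10"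
  shows "- im_lower p q \<le> (p + q)/1600 * re_lower p q"
proof -
  define A where "A = 8168/10 - (625/24 + 647/10) * q + 1021875/1000000 * q^2"
  define B where "B = 7132/10 + (137/10 - 625/24 - 625/40) * q - (15625/1000 + 95/10) * p
    - 2581875/1000000 * q^2 - 784375/1000000 * (p * q) + 28375/1000000 * p^2"
  \<comment> \<open>Tangent of \<open>q\<^sup>2\<close> near the right end of the range of \<open>q\<close>, where \<open>A\<close> is smallest.\<close>
  have "0 \<le> (q - 98/10)^2" by simp
  then have "196/10 * q - 9604/100 \<le> q^2" by (simp add: power2_eq_square algebra_simps)
  then have "0 \<le> A" using pq unfolding A_def by argo
  moreover have "q^2 \<le> 987/100 * q"
    using pq unfolding power2_eq_square by (intro mult_right_mono) auto
  then have "0 \<le> B"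
    using pq zero_le_power2[of p] unfolding B_def by argo
  ultimately have "0 \<le> q * A + p * B" using pq by simp
  also have "\<dots> = 1000000 * ((p + q)/1600 * re_lower p q + im_lower p q)"
    unfolding A_def B_def im_lower_def re_lower_def
    by (simp add: field_simps power2_eq_square power3_eq_cube)
  finally show ?thesis by (simp add: field_simps)
qed

text \<open>
  The left-hand side is positive only for large \<open>q\<close>, or for \<open>p\<close> close to its maximum. For
  \<open>d \<le> 1.75\<close> crude bounds suffice. For larger \<open>d\<close> the terms containing \<open>p\<close> contribute at most \<open>64\<close> (in units of \<open>10\<^sup>-\<^sup>6\<close>) to
  \<open>- im_lower p q\<close>, and what is left depends on \<open>d\<close> alone after
  \<open>s\<close> has been replaced by its largest value \<open>3.142 - d\<close>.
\<close>

lemma minus_im_lower_le_uniform: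
  assumes s: "0 \<le> s" and d: "0 \<le> d" and sd: "s + d \<le> 3142/1000"
    and pq: "p = s^2" "q = d^2" "p + q \<le> 987/100" "p * q \<le> 61/10"
  shows "s * (- im_lower p q) \<le> re_lower p q / 800"
proof -
  define N where "N = - 1000000 * im_lower p q"
  have p0: "0 \<le> p" and q0: "0 \<le> q" using pq by auto
  have sle: "s \<le> 3142/1000" using sd d by argo
  have N: "N = 647/10 * q^2 - 725/1000 * q^3 - 1918/10 * q
    + p * (406/100 * q^2 + 21/10 * (p * q) + 95/10 * p + 106/1000 * p^2 - 882/10 - 137/10 * q)"
    unfolding N_def im_lower_def by (simp add: field_simps power2_eq_square power3_eq_cube)
  have "s * N \<le> 1250 * re_lower p q"
  proof (cases "d \<le> 175/100")
    case True
    have "q \<le> (175/100)^2" unfolding pq(2) using True d by (intro power_mono)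
    then have q: "q \<le> 49/16" by (simp add: power2_eq_square)
    have qq: "q^2 \<le> 49/16 * q"
      unfolding power2_eq_square using q q0 by (intro mult_right_mono)
    have pp: "p^2 \<le> 987/100 * p"
      unfolding power2_eq_square using p0 q0 pq(3) by (intro mult_right_mono) auto
    have "N \<le> 20 + p * (21/10 * (p * q) + 95/10 * p + 106/1000 * p^2 - 882/10)"
    proof -
      have "p * (406/100 * q^2 + 21/10 * (p * q) + 95/10 * p + 106/1000 * p^2 - 882/10 - 137/10 * q)
        \<le> p * (21/10 * (p * q) + 95/10 * p + 106/1000 * p^2 - 882/10)"
        using qq q0 p0 by (intro mult_left_mono) auto
      moreover have "0 \<le> q^3" using q0 by simp
      ultimately show ?thesis using qq q unfolding N by argo
    qed
    moreover have "p * (21/10 * (p * q) + 95/10 * p + 106/1000 * p^2 - 882/10) \<le> 200"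
    proof (cases "p \<le> 8")
      case True
      have "p^2 \<le> 8 * p"
        unfolding power2_eq_square using p0 True by (intro mult_right_mono)
      then have "p * (21/10 * (p * q) + 95/10 * p + 106/1000 * p^2 - 882/10) \<le> p * 8"
        using p0 pq(4) True by (intro mult_left_mono) auto
      then show ?thesis using True by argo
    next
      case False
      have "282/100 < s"
      proof (rule ccontr)
        assume "\<not> 282/100 < s"
        then have "p \<le> (282/100)^2" unfolding pq(1) using s by (intro power_mono) auto
        then show False using False by (simp add: power2_eq_square)
      qed
      then have "d \<le> 322/1000" using sd by argo
      then have "q \<le> (322/1000)^2" unfolding pq(2) using d by (intro power_mono)
      then have q: "q \<le> 11/100" by (simp add: power2_eq_square)
      have "p * q \<le> 10 * (11/100)"
        using q q0 p0 pq(3) by (intro mult_mono) auto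
      then have "p * (21/10 * (p * q) + 95/10 * p + 106/1000 * p^2 - 882/10) \<le> p * (185/10)"
        using p0 q0 pp pq(3) by (intro mult_left_mono) auto
      then show ?thesis using pq(3) q0 by argo
    qed
    ultimately have "N \<le> 220" by argo
    then have "s * N \<le> s * 220" using s by (intro mult_left_mono)
    also have "\<dots> \<le> 1250 * (1 - q/24 - p/40)" using sle pq(3) p0 q0 by argo
    also have "\<dots> \<le> 1250 * re_lower p q" using re_lower_ge[OF p0 q0] by simp
    finally show ?thesis .
  next
    case False
    define M where "M = 647/10 * q^2 - 298 * q + 561"
    have "(175/100)^2 \<le> q" unfolding pq(2) using False by (intro power_mono) auto
    then have q: "49/16 \<le> q" by (simp add: power2_eq_square)
    have sd': "s \<le> 3142/1000 - d" using sd by simp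
    have p_le: "p \<le> (3142/1000 - d)^2" unfolding pq(1) using s sd' by (intro power_mono)
    have "p \<le> (1392/1000)^2" unfolding pq(1) using s sd False by (intro power_mono) auto
    then have p: "p \<le> 194/100" by (simp add: power2_eq_square)
    have pp: "p^2 \<le> 194/100 * p"
      unfolding power2_eq_square using p0 p by (intro mult_right_mono)
    have cross: "p * (406/100 * q^2 + 21/10 * (p * q) + 95/10 * p + 106/1000 * p^2 - 882/10 - 137/10 * q) \<le> 64"
    proof (cases "q \<le> 66/10")
      case True
      have "q^2 \<le> 66/10 * q"
        unfolding power2_eq_square using q0 True by (intro mult_right_mono)
      then have "p * (406/100 * q^2 + 21/10 * (p * q) + 95/10 * p + 106/1000 * p^2 - 882/10 - 137/10 * q) \<le> p * 32"
        using p0 pq(4) True p pp by (intro mult_left_mono) argo+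
      then show ?thesis using p by argo
    next
      case False
      have "2569/1000 < d"
      proof (rule ccontr)
        assume "\<not> 2569/1000 < d"
        then have "q \<le> (2569/1000)^2" unfolding pq(2) using d by (intro power_mono) auto
        then show False using False by (simp add: power2_eq_square)
      qed
      then have "s \<le> 573/1000" using sd by argo
      then have "p \<le> (573/1000)^2" unfolding pq(1) using s by (intro power_mono)
      then have p: "p \<le> 329/1000" by (simp add: power2_eq_square)
      have "p * q \<le> 329/1000 * (987/100)"
        using p p0 q0 pq(3) by (intro mult_mono) auto
      moreover have "q^2 \<le> 987/100 * q"
        unfolding power2_eq_square using q0 p0 pq(3) by (intro mult_right_mono) auto
      ultimately have "p * (406/100 * q^2 + 21/10 * (p * q) + 95/10 * p + 106/1000 * p^2 - 882/10 - 137/10 * q) \<le> p * 185"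
        using p0 p pp pq(3) by (intro mult_left_mono) argo+
      then show ?thesis using p by argo
    qed
    \<comment> \<open>The convex function \<open>q\<^sup>3\<close> lies above its tangent at \<open>7\<close>.\<close>
    have "0 \<le> (q - 7)^2 * (q + 14)" using q0 by simp
    then have "147 * q - 686 \<le> q^3"
      by (simp add: power2_eq_square power3_eq_cube algebra_simps)
    then have NM: "N \<le> M" using cross q unfolding N M_def by argo
    have "0 \<le> (q - 23/10)^2" by simp
    then have "46/10 * q - 529/100 \<le> q^2" by (simp add: power2_eq_square algebra_simps)
    then have M0: "0 \<le> M" unfolding M_def using q0 p0 pq(3) by argo
    have "s * N \<le> s * M" using NM s by (intro mult_left_mono)
    also have "\<dots> \<le> (3142/1000 - d) * M" using M0 sd' by (intro mult_right_mono)
    also have "\<dots> \<le> 1250 * (96/100 - 33/1000 * q - (3142/1000 - d)^2/40)"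
    proof -
      \<comment> \<open>Expansion at \<open>2.65\<close>, close to the minimum of the difference.\<close>
      define v where "v = d - 265/100"
      have v: "-9/10 \<le> v" "v \<le> 492/1000" unfolding v_def using False sd s by auto
      have dv: "d = v + 265/100" unfolding v_def by simp
      have expand: "1250 * (96/100 - 33/1000 * q - (3142/1000 - d)^2/40) - (3142/1000 - d) * M
        = (34610125539/400000000 - 4854322121/40000000 * v)
          + v^2 * (246203597/125000 + 104535553/50000 * v + 1634969/2500 * v^2 + 647/10 * (v * v^2))"
        unfolding M_def pq(2) dv by algebra
      have "0 \<le> 246203597/125000 + 104535553/50000 * v + 1634969/2500 * v^2 + 647/10 * (v * v^2)"
      proof -
        have "0 \<le> (v + 16/10)^2" by simp
        then have "- 32/10 * v - 256/100 \<le> v^2" by (simp add: power2_eq_square algebra_simps)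
        moreover have "- 1 * v^2 \<le> v * v^2" using v by (intro mult_right_mono) auto
        ultimately show ?thesis using v by argo
      qed
      then have "0 \<le> v^2 * (246203597/125000 + 104535553/50000 * v + 1634969/2500 * v^2 + 647/10 * (v * v^2))"
        by simp
      moreover have "0 \<le> 34610125539/400000000 - 4854322121/40000000 * v" using v by argo
      ultimately show ?thesis using expand by linarith
    qed
    also have "\<dots> \<le> 1250 * re_lower p q" using re_lower_ge(2)[OF p0 q0] p_le by simp
    finally show ?thesis .
  qed
  then show ?thesis unfolding N_def by simp
qed

text \<open>
  This is the tight inequality. For \<open>s \<le> 1.7\<close> the polynomial, seen as a function of \<open>q\<close>, is bounded by a concave
  parabola whose maximum is small enough. For \<open>s \<ge> 1.7\<close> the right-hand side minus the left-hand side is smallest at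
  the largest \<open>q\<close>, on the hypotenuse \<open>d = 3.142 - s\<close>; there it is a polynomial in \<open>s\<close> alone, whose minimum near
  \<open>s = 2.15\<close> is less than two percent of the right-hand side.
\<close>

lemma im_upper_le_uniform:
  assumes s: "0 \<le> s" and d: "0 \<le> d" and sd: "s + d \<le> 3142/1000"
    and pq: "p = s^2" "q = d^2" "p + q \<le> 987/100" "p * q \<le> 61/10"
  shows "s * im_upper p q \<le> re_lower p q / 800"
proof -
  define U where "U p q = 192 * q - 64 * q^2 + 92/100 * q^3 + 883/10 * p + 147/10 * (p * q) + 7 * (p * q^2)
     - 917/100 * p^2 + 153/100 * (p^2 * q) + 194/1000 * p^3" for p q :: real
  have U: "1000000 * im_upper p q = U p q" unfolding im_upper_def U_def by simp
  have p0: "0 \<le> p" and q0: "0 \<le> q" using pq by auto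
  \<comment> \<open>Cubic terms are lowered by the bounds on \<open>p\<close> and \<open>q\<close>, and \<open>p\<^sup>2\<close> by its tangent at \<open>c\<close>.\<close>
  have U_le: "U p q \<le> (192 + 147/10 * a + 153/100 * a^2) * q + (7 * a - 64 + 92/100 * b) * q^2
      + 883/10 * p - 917/100 * (2 * c * p - c^2) + 194/1000 * a^2 * p"
    if a: "p \<le> a" and b: "q \<le> b" for a b c
  proof -
    have "0 \<le> (p - c)^2" by simp
    then have "2 * c * p - c^2 \<le> p^2" by (simp add: power2_eq_square algebra_simps)
    moreover
    have "p^2 \<le> a^2" using a p0 by (intro power_mono)
    then have "p^2 * q \<le> a^2 * q" "p^2 * p \<le> a^2 * p" using p0 q0 by (auto intro: mult_right_mono)
    moreover have "p * q \<le> a * q" "p * q^2 \<le> a * q^2" "q * q^2 \<le> b * q^2"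
      using a b q0 by (auto intro: mult_right_mono)
    moreover have "q^3 = q * q^2" "p^3 = p^2 * p" by (simp_all add: power2_eq_square power3_eq_cube)
    ultimately show ?thesis unfolding U_def ring_distribs by argo
  qed
  have "s * U p q \<le> 1250 * re_lower p q"
  proof (cases "s \<le> 17/10")
    case small: True
    have "s * U p q \<le> 1250 * (1 - q/24 - p/40)"
    proof (cases "s \<le> 14/10")
      case True
      have "p \<le> (14/10)^2" unfolding pq(1) using s True by (intro power_mono)
      then have p: "p \<le> 196/100" by (simp add: power2_eq_square)
      have "0 \<le> (q - 275/100)^2" by simp
      then have "550/100 * q - 75625/10000 \<le> q^2" by (simp add: power2_eq_square algebra_simps)
      moreover have "q \<le> 987/100" using pq(3) p0 by simp
      ultimately have "U p q \<le> 500"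
        using U_le[of "196/100" "987/100" 0] p p0 q0 by (simp add: power2_eq_square)
      then have "s * U p q \<le> s * 500" using s by (intro mult_left_mono)
      also have "\<dots> \<le> 1250 * (1 - q/24 - p/40)" using True pq(3) p0 q0 by argo
      finally show ?thesis .
    next
      case False
      have "p \<le> (17/10)^2" unfolding pq(1) using s small by (intro power_mono)
      then have p: "p \<le> 289/100" by (simp add: power2_eq_square)
      have "q \<le> (1742/1000)^2" unfolding pq(2) using d sd False by (intro power_mono) auto
      then have q: "q \<le> 3035/1000" by (simp add: power2_eq_square)
      have "0 \<le> (q - 3)^2" by simp
      then have "6 * q - 9 \<le> q^2" by (simp add: power2_eq_square algebra_simps)
      then have "U p q \<le> 570"
        using U_le[OF p q, of "289/100"] p p0 q q0 by (simp add: power2_eq_square) argo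
      then have "s * U p q \<le> s * 570" using s by (intro mult_left_mono)
      also have "\<dots> \<le> 1250 * (1 - q/24 - p/40)" using small p q by argo
      finally show ?thesis .
    qed
    also have "\<dots> \<le> 1250 * re_lower p q" using re_lower_ge[OF p0 q0] by simp
    finally show ?thesis .
  next
    case False
    define Q where "Q = (3142/1000 - s)^2"
    have qQ: "q \<le> Q" unfolding pq(2) Q_def using d sd by (intro power_mono) auto
    have "Q \<le> (1442/1000)^2" unfolding Q_def using False d sd by (intro power_mono) auto
    then have Q: "Q \<le> 208/100" by (simp add: power2_eq_square)
    have "(17/10)^2 \<le> p" unfolding pq(1) using False by (intro power_mono) auto
    then have p: "289/100 \<le> p" by (simp add: power2_eq_square)
    \<comment> \<open>The difference at \<open>q\<close> minus the difference at \<open>Q\<close> is \<open>(Q - q) K\<close>.\<close>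
    define J where "J = 192 + 147/10 * p + 153/100 * p^2 + 92/100 * (Q^2 + Q * q + q^2) - (64 - 7 * p) * (Q + q)"
    define K where "K = 1250/24 - 23625/10000 * p - 59375/100000 * (Q + q) + s * J"
    have "0 \<le> J"
    proof -
      have "289/100 * (Q + q) \<le> p * (Q + q)" using p q0 qQ by (intro mult_right_mono) auto
      moreover have "(289/100) * (289/100) \<le> p^2" using p unfolding power2_eq_square by (intro mult_mono) auto
      moreover have "0 \<le> Q^2 + Q * q + q^2" using q0 qQ by simp
      ultimately show ?thesis using p q0 qQ Q unfolding J_def ring_distribs by argo
    qed
    then have "0 \<le> s * J" using s by simp
    then have "0 \<le> K" using p q0 qQ Q pq(3) unfolding K_def by argo
    then have "0 \<le> (Q - q) * K" using qQ by simp
    also have "\<dots> = (1250 * re_lower p q - s * U p q) - (1250 * re_lower p Q - s * U p Q)"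
      unfolding K_def J_def U_def re_lower_def by (simp add: field_simps power2_eq_square power3_eq_cube)
    finally have "1250 * re_lower p Q - s * U p Q \<le> 1250 * re_lower p q - s * U p q" by simp
    moreover have "0 \<le> 1250 * re_lower p Q - s * U p Q"
    proof -
      \<comment> \<open>Expansion at \<open>2.15\<close>, close to the minimum: the linear part stays positive for \<open>v \<le> 1\<close>,
        and the coefficient of \<open>v\<^sup>2\<close> exceeds the sum of the moduli of the higher ones.\<close>
      define v where "v = s - 215/100"
      have v: "-1/2 \<le> v" "v \<le> 1" unfolding v_def using False sd d by auto
      have sv: "s = v + 215/100" unfolding v_def by simp
      define T where "T = 3640314876548450003/4687500000000000 + (-71282144103349/312500000000) * v + (-276191652067/2500000000) * v^2 + 974622297/25000000 * v^3 + (-188799/6250) * v^4 + (-2411/250) * v^5"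
      have expand: "1250 * re_lower p Q - s * U p Q = (1754274263039647806547/93750000000000000000 + (-11855768154659948921/4687500000000000000) * v) + v^2 * T"
        unfolding T_def U_def re_lower_def Q_def pq(1) sv by algebra
      have "0 \<le> T"
      proof -
        have "\<bar>v\<bar> \<le> 1" using v by simp
        then have "\<bar>v ^ n\<bar> \<le> 1" for n by (simp add: power_abs power_le_one)
        from this[of 2] this[of 3] this[of 4] this[of 5] show ?thesis
          unfolding T_def using v by (simp add: abs_le_iff)
      qed
      then have "0 \<le> v^2 * T" by simp
      moreover have "0 \<le> 1754274263039647806547/93750000000000000000 + (-11855768154659948921/4687500000000000000) * v"
        using v by argo
      ultimately show ?thesis using expand by linarith
    qed
    ultimately show ?thesis by simp
  qed
  then show ?thesis unfolding U[symmetric] by simp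
qed

section \<open>The bound on the angle defect\<close>

theorem theorem3p2:
  shows "(\<exists>c1 c2 :: real.
            \<forall>\<beta>0 \<in> {-pi/2..pi/2}. \<forall>\<beta>1 \<in> {-pi/2..pi/2}.
              \<bar>angle_defect f_tilde \<beta>0 \<beta>1\<bar>
                \<le> min c1 (c2 * \<bar>\<beta>0 + \<beta>1\<bar> * (\<beta>0\<^sup>2 + \<beta>1\<^sup>2)))
       \<and> (\<forall>\<beta>0 \<in> {-pi/2..pi/2}. \<forall>\<beta>1 \<in> {-pi/2..pi/2}.
              \<bar>angle_defect f_tilde \<beta>0 \<beta>1\<bar>
                \<le> min (1/800) (1/800 * \<bar>\<beta>0 + \<beta>1\<bar> * (\<beta>0\<^sup>2 + \<beta>1\<^sup>2)))"
proof -
  have "\<bar>angle_defect f_tilde a b\<bar> \<le> min (1/800) (1/800 * \<bar>a + b\<bar> * (a\<^sup>2 + b\<^sup>2))"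
    if a: "a \<in> {-pi/2..pi/2}" and b: "b \<in> {-pi/2..pi/2}" for a b
  proof -
    define Z where "Z = direction_integral (quad_interp f_tilde a b)"
    define s d p q e where "s = \<bar>a + b\<bar>" and "d = \<bar>b - a\<bar>" and "p = s^2" and "q = d^2"
      and "e = (3 * p + 20 * q) / 1564"
    have s: "0 \<le> s" and d: "0 \<le> d" unfolding s_def d_def by auto
    have sd_pi: "s + d \<le> pi" using a b unfolding s_def d_def by auto
    then have sd: "s + d \<le> 3142/1000" using pi_approx by simp
    have p0: "0 \<le> p" and q0: "0 \<le> q" unfolding p_def q_def by auto
    have "(s + d)^2 \<le> (31416/10000)^2" using sd_pi pi_approx s d by (intro power_mono) auto
    then have "(s + d)^2 \<le> 987/100" by (simp add: power2_eq_square)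
    moreover have "(s + d)^2 = p + q + 2 * (s * d)" "(s + d)^2 = (s - d)^2 + 4 * (s * d)"
      unfolding p_def q_def by (simp_all add: power2_eq_square algebra_simps)
    ultimately have sum: "p + q \<le> 987/100" and "s * d \<le> 2468/1000"
      using mult_nonneg_nonneg[OF s d] zero_le_power2[of "s - d"] by argo+
    then have "(s * d)^2 \<le> (2468/1000)^2" using s d by (intro power_mono) auto
    also have "(2468/1000)^2 \<le> (61/10 :: real)" by (simp add: power2_eq_square)
    also have "(s * d)^2 = p * q" unfolding p_def q_def by (rule power_mult_distrib)
    finally have prod: "p * q \<le> 61/10" .
    note pq = p0 q0 sum prod
    have e: "0 \<le> e" "e \<le> 1/2" using profile_parameter_bounds[OF pq e_def] by auto
    have e_ab: "(3 * (a + b)^2 + 20 * (a - b)^2) / 1564 = e"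
      unfolding e_def p_def q_def s_def d_def by (simp add: power2_commute)
    have angles: "cos (\<bar>c\<bar> / 2 * x) = cos (c / 2 * x)" "cos (\<bar>c\<bar> * x) = cos (c * x)"
      "sin (\<bar>c\<bar> * x) = sgn c * sin (c * x)" for c x :: real
      by (simp_all add: abs_if sgn_if)
    note comps = direction_integral_components[of a b, unfolded e_ab, folded Z_def]
    have "((\<lambda>t. sin (s * profile e ((2*t - 1)^2)) * cos (d/2 * (2*t - 1))) has_integral sgn (a + b) * Im Z) {0..1}"
      using has_integral_mult_right[OF comps(1), of "sgn (a + b)"] unfolding s_def d_def angles by (simp add: mult.assoc)
    from sin_integral_bounds[OF s e this]
    have im: "\<bar>sgn (a + b) * Im Z - s * im_main p q e\<bar> \<le> s * im_tail p q" unfolding p_def q_def .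
    have re: "re_lower p q \<le> Re Z"
      using cos_integral_lower_bound[OF s, of d e "Re Z"] comps(2) sd_pi d e re_lower_le[OF pq e_def]
      unfolding s_def d_def angles p_def q_def by simp
    \<comment> \<open>The product \<open>sgn (a + b) * Im Z\<close> is \<open>s F\<close>, which is enclosed from both sides.\<close>
    have "s * im_lower p q \<le> sgn (a + b) * Im Z" "sgn (a + b) * Im Z \<le> s * im_upper p q"
      using im mult_left_mono[OF im_lower_le[OF pq e_def] s] mult_left_mono[OF im_main_plus_tail_le[OF pq e_def] s]
      by (simp_all add: abs_le_iff algebra_simps)
    \<comment> \<open>For \<open>a + b = 0\<close> the factor \<open>sgn (a + b)\<close> loses all information, but then the integrand vanishes.\<close>
    moreover have "s = 0 \<Longrightarrow> Im Z = 0"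
      using comps(1) unfolding s_def by (auto dest: has_integral_is_0 intro: has_integral_unique)
    ultimately have Im: "\<bar>Im Z\<bar> \<le> max (s * im_upper p q) (s * (- im_lower p q))"
      unfolding s_def by (auto simp: sgn_if abs_if max_def split: if_splits)
    have R0: "0 < re_lower p q" using re_lower_ge(1)[OF p0 q0] sum p0 q0 by argo
    have "\<bar>Im Z\<bar> \<le> re_lower p q / 800"
      using Im im_upper_le_uniform[OF s d sd p_def q_def sum prod]
        minus_im_lower_le_uniform[OF s d sd p_def q_def sum prod] by linarith
    also have "\<dots> \<le> 1/800 * Re Z" using re by simp
    finally have bound1: "\<bar>angle_defect f_tilde a b\<bar> \<le> 1/800"
      unfolding angle_defect_def Z_def[symmetric] using re R0 by (intro abs_Arg_le) auto
    have "\<bar>Im Z\<bar> \<le> s * ((p + q)/1600 * re_lower p q)"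
      using Im mult_left_mono[OF im_upper_le_proportional[OF pq] s]
        mult_left_mono[OF minus_im_lower_le_proportional[OF pq] s] by linarith
    also have "\<dots> \<le> s * ((p + q)/1600 * Re Z)"
      using re s p0 q0 by (intro mult_left_mono) auto
    also have "p + q = 2 * (a^2 + b^2)"
      unfolding p_def q_def s_def d_def by (simp add: power2_eq_square algebra_simps)
    finally have bound2: "\<bar>angle_defect f_tilde a b\<bar> \<le> 1/800 * \<bar>a + b\<bar> * (a^2 + b^2)"
      unfolding angle_defect_def Z_def[symmetric] using re R0
      by (intro abs_Arg_le) (auto simp: s_def algebra_simps)
    show ?thesis using bound1 bound2 by simp
  qed
  then show ?thesis by blast
qed

end
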